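(* Let $R$ be an explicitly given finite $\mathbb{Z}$-algebra, with generators $\mathcal{G}=(g_0,\dots,g_n)$ of $R^+$, relation matrix $A=(a_{jk})\in \mathrm{Mat}_{m,n+1}(\mathbb{Z})$ (with $j=1,\dots,m$ and $k=0,\dots,n$) and structure constants $c_{ij\ell}$. Let $f_1,\dots,f_p\in R$, and for $k=1,\dots,p$ write $f_k=b_{k0}g_0+\cdots+b_{kn}g_n$ with $b_{kj}\in\mathbb{Z}$. Let $y_1,\dots,y_p$ be indeterminates and consider the homogeneous linear equation over $R$ $$\text{(i)}\qquad f_1y_1+\cdots+f_py_p=0 .$$ Let $e_0,\dots,e_n\in\mathbb{Z}^{n+1}$ be the standard basis vectors. Consider the following system of homogeneous linear equations over $\mathbb{Z}$ in the indeterminates $z_{ki}$ ($k=1,\dots,p$, $i=0,\dots,n$) and $w_j$ ($j=1,\dots,m$): $$\text{(ii)}\qquad \sum_{k=1}^p\ \sum_{i,j,\ell=0}^n z_{ki}\,b_{kj}\,c_{ij\ell}\,e_\ell\;-\;\sum_{j=1}^m\sum_{i=0}^n w_j\,a_{ji}\,e_i\;=\;0,$$ and let $\mathcal{L}$ be the projection of its set of integer solutions onto the $z$-coordinates. Let $(h_1,\dots,h_p)\in R^p$ with $h_k=d_{k0}g_0+\cdots+d_{kn}g_n$, where $d_{ki}\in\mathbb{Z}$. Then the following conditions are equivalent: (a) The tuple $(h_1,\dots,h_p)$ is a solution of (i). (b) The tuple $(d_{ki})$ is an element of $\mathcal{L}$.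
   Context: All rings are commutative with $1$. A finite $\mathbb{Z}$-algebra is a $\mathbb{Z}$-algebra $R$ which is a finitely generated $\mathbb{Z}$-module; $R^+$ denotes its additive group. $R$ is called explicitly given if it is given by (a) generators $\mathcal{G}=(g_0,\dots,g_n)$ of the $\mathbb{Z}$-module $R^+$ with $g_0=1$, together with a matrix $A\in\mathrm{Mat}_{m,n+1}(\mathbb{Z})$ whose rows generate the syzygy module $\mathrm{Syz}_{\mathbb{Z}}(\mathcal{G})=\{(c_0,\dots,c_n)\in\mathbb{Z}^{n+1}\mid \sum_k c_kg_k=0\}$, and (b) structure constants $c_{ijk}\in\mathbb{Z}$ such that $g_ig_j=\sum_{k=0}^n c_{ijk}g_k$ for $i,j=0,\dots,n$. *)

theory Defs
  imports "Jordan_Normal_Form.VS_Connect"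
begin

text \<open>Integers act on a ring through \<^const>\<open>add_pow\<close>; this is the unique
  \<open>\<int>\<close>-algebra structure. The index ranges over \<open>0, \<dots>, n\<close>.\<close>

definition zlincomb :: "('a, 'b) ring_scheme \<Rightarrow> nat \<Rightarrow> (nat \<Rightarrow> 'a) \<Rightarrow> (nat \<Rightarrow> int) \<Rightarrow> 'a"
  where "zlincomb R n g a = (\<Oplus>\<^bsub>R\<^esub>k\<in>{..n}. [a k] \<cdot>\<^bsub>R\<^esub> g k)"

definition syzygies :: "('a, 'b) ring_scheme \<Rightarrow> nat \<Rightarrow> (nat \<Rightarrow> 'a) \<Rightarrow> int vec set"
  where "syzygies R n g =
    {v \<in> carrier_vec (Suc n). zlincomb R n g (\<lambda>k. v $ k) = \<zero>\<^bsub>R\<^esub>}"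

text \<open>Locale \<^locale>\<open>cring\<close> admits the zero ring. The assumption
  \<open>generates\<close> makes \<open>R\<close> a finitely generated \<open>\<int>\<close>-module.
  Values of \<open>g\<close> and \<open>c\<close> at indices above \<open>n\<close> are irrelevant.\<close>

locale explicitly_given_finite_Z_algebra = cring R
  for R :: "('a, 'b) ring_scheme" (structure) and n m :: nat and g :: "nat \<Rightarrow> 'a" and A :: "int mat"
    and c :: "nat \<Rightarrow> nat \<Rightarrow> nat \<Rightarrow> int" +
  assumes generators_closed: "g \<in> {..n} \<rightarrow> carrier R"
    and generates: "\<And>x. x \<in> carrier R \<Longrightarrow> \<exists>a. x = zlincomb R n g a"
    and generator_0: "g 0 = \<one>"
    and relation_matrix: "A \<in> carrier_mat m (Suc n)"
    and rows_generate_syzygies: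
      "LinearCombinations.module.span class_ring (module_vec TYPE(int) (Suc n)) (set (rows A))
        = syzygies R n g"
    and structure_constants:
      "\<And>i j. i \<le> n \<Longrightarrow> j \<le> n \<Longrightarrow> g i \<otimes> g j = zlincomb R n g (c i j)"

text \<open>The indices \<open>k = 1, \<dots>, p\<close> and \<open>j = 1, \<dots>, m\<close> are shifted to
  \<open>0, \<dots>, p - 1\<close> and \<open>0, \<dots>, m - 1\<close>, as matrix rows are counted from 0.\<close>

definition is_ring_solution ::
  "('a, 'b) ring_scheme \<Rightarrow> nat \<Rightarrow> (nat \<Rightarrow> 'a) \<Rightarrow> (nat \<Rightarrow> 'a) \<Rightarrow> bool"
  where "is_ring_solution R p f y \<longleftrightarrow>
    y \<in> {..<p} \<rightarrow> carrier R \<and> (\<Oplus>\<^bsub>R\<^esub>k\<in>{..<p}. f k \<otimes>\<^bsub>R\<^esub> y k) = \<zero>\<^bsub>R\<^esub>"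

definition is_int_solution ::
  "nat \<Rightarrow> nat \<Rightarrow> nat \<Rightarrow> int mat \<Rightarrow> int mat \<Rightarrow> (nat \<Rightarrow> nat \<Rightarrow> nat \<Rightarrow> int) \<Rightarrow> int mat \<Rightarrow> int vec \<Rightarrow> bool"
  where "is_int_solution n m p A B c Z w \<longleftrightarrow>
    Z \<in> carrier_mat p (Suc n) \<and> w \<in> carrier_vec m \<and>
    finsum_vec TYPE(int) (Suc n)
      (\<lambda>(k, i, j, l). (Z $$ (k, i) * B $$ (k, j) * c i j l) \<cdot>\<^sub>v unit_vec (Suc n) l)
      ({..<p} \<times> {..n} \<times> {..n} \<times> {..n})
    - finsum_vec TYPE(int) (Suc n)
      (\<lambda>(j, i). (w $ j * A $$ (j, i)) \<cdot>\<^sub>v unit_vec (Suc n) i)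
      ({..<m} \<times> {..n})
    = 0\<^sub>v (Suc n)"

definition z_projection ::
  "nat \<Rightarrow> nat \<Rightarrow> nat \<Rightarrow> int mat \<Rightarrow> int mat \<Rightarrow> (nat \<Rightarrow> nat \<Rightarrow> nat \<Rightarrow> int) \<Rightarrow> int mat set"
  where "z_projection n m p A B c = {Z. \<exists>w. is_int_solution n m p A B c Z w}"

end

theory Submission
  imports Defs
begin

text \<open>
  Let \<open>\<pi> : \<int>\<^sup>n\<^sup>+\<^sup>1 \<rightarrow> R\<close> be the additive map sending a coordinate vector to the corresponding
  combination of the generators, so that \<open>f\<^sub>k = \<pi> (B\<^sub>k)\<close> and \<open>h\<^sub>k = \<pi> (D\<^sub>k)\<close> for the rows
  \<open>B\<^sub>k\<close>, \<open>D\<^sub>k\<close> of the coordinate matrices. The structure constants lift the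
  multiplication of \<open>R\<close> to a bilinear map on \<open>\<int>\<^sup>n\<^sup>+\<^sup>1\<close> (\<open>zlincomb_mult\<close>), and therefore
  \<open>\<Sum>\<^sub>k f\<^sub>k h\<^sub>k = \<pi> F\<close>, where \<open>F\<close> is the first vector in the integer system.

  Hence \<open>h\<close> solves the equation over \<open>R\<close> exactly if \<open>F\<close> is a syzygy of the generators. By
  hypothesis the syzygies are the \<open>\<int>\<close>-span of the rows of \<open>A\<close>, and this span consists of
  the vectors \<open>A\<^sup>T w\<close> with \<open>w \<in> \<int>\<^sup>m\<close> (\<open>span_rows_eq_range_transpose\<close>). The second vector in
  the integer system is \<open>A\<^sup>T w\<close>, so such a \<open>w\<close> is precisely what is needed to complete \<open>D\<close>
  to an integer solution.
\<close>

text \<open>The span ranges over the set of rows, which forgets repetitions and order; passing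
  through the list-based span restores one coefficient for each row.\<close>

lemma (in idom_vec) span_rows_eq_range_transpose:
  assumes "A \<in> carrier_mat m n"
  shows "span (set (rows A)) = (\<lambda>w. transpose_mat A *\<^sub>v w) ` carrier_vec m"
proof -
  have rows: "set (rows A) \<subseteq> carrier_vec n"
    using assms by (auto simp: rows_def)
  have len: "length (rows A) = m"
    using assms by simp
  have "mat_of_cols n (rows A) = transpose_mat A"
    using assms by (metis carrier_matD(2) cols_transpose index_transpose_mat(2) mat_of_cols_cols)
  then have lin: "lincomb_list a (rows A) = transpose_mat A *\<^sub>v vec m a" for a
    using rows len by (subst lincomb_list_as_mat_mult) auto
  have "w \<in> range (vec m)" if "w \<in> carrier_vec m" for w :: "'a vec"
  proof
    show "w = vec m (($) w)" using that by auto
  qed simp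
  then have "range (vec m) = (carrier_vec m :: 'a vec set)"
    by auto
  then have "(\<lambda>w. transpose_mat A *\<^sub>v w) ` carrier_vec m = span_list (rows A)"
    unfolding span_list_def lin by force
  then show ?thesis
    using span_list_as_span[OF rows] by simp
qed

context cring
begin

lemma zlincomb_closed [simp]:
  assumes "g \<in> {..n} \<rightarrow> carrier R"
  shows "zlincomb R n g a \<in> carrier R"
  using assms unfolding zlincomb_def by (intro finsum_closed) auto

lemma zlincomb_zero: "zlincomb R n g (\<lambda>_. 0) = \<zero>"
  by (simp add: zlincomb_def add_pow_def)

lemma zlincomb_add:
  assumes "g \<in> {..n} \<rightarrow> carrier R"
  shows "zlincomb R n g (\<lambda>k. a k + b k) = zlincomb R n g a \<oplus> zlincomb R n g b"
proof -
  have "zlincomb R n g (\<lambda>k. a k + b k) = (\<Oplus>k\<in>{..n}. [a k] \<cdot> g k \<oplus> [b k] \<cdot> g k)"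
    unfolding zlincomb_def using assms
    by (intro finsum_cong') (auto simp: Pi_iff add.int_pow_mult)
  also have "\<dots> = zlincomb R n g a \<oplus> zlincomb R n g b"
    unfolding zlincomb_def using assms by (intro finsum_addf) auto
  finally show ?thesis .
qed

lemma zlincomb_sum:
  assumes "g \<in> {..n} \<rightarrow> carrier R" and "finite I"
  shows "zlincomb R n g (\<lambda>k. \<Sum>i\<in>I. a i k) = (\<Oplus>i\<in>I. zlincomb R n g (a i))"
  using assms(2)
proof (induction rule: finite_induct)
  case empty
  then show ?case using zlincomb_zero by simp
next
  case (insert i I)
  then show ?case using assms(1) by (simp add: zlincomb_add)
qed

text \<open>Multiplication by the image of \<open>s\<close> in \<open>R\<close> turns this into distributivity of
  \<open>\<otimes>\<close> over sums.\<close>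

lemma zlincomb_smult:
  assumes "g \<in> {..n} \<rightarrow> carrier R"
  shows "zlincomb R n g (\<lambda>k. s * a k) = [s] \<cdot> zlincomb R n g a"
proof -
  have scalar: "[s] \<cdot> x = ([s] \<cdot> \<one>) \<otimes> x" if "x \<in> carrier R" for x
    using that by (simp add: add_pow_ldistr_int)
  have "zlincomb R n g (\<lambda>k. s * a k) = (\<Oplus>k\<in>{..n}. ([s] \<cdot> \<one>) \<otimes> ([a k] \<cdot> g k))"
    unfolding zlincomb_def using assms
    by (intro finsum_cong')
       (auto simp: Pi_iff scalar[symmetric] add.int_pow_pow mult.commute)
  also have "\<dots> = ([s] \<cdot> \<one>) \<otimes> zlincomb R n g a"
    unfolding zlincomb_def using assms by (intro finsum_rdistr[symmetric]) auto
  finally show ?thesis using assms by (simp add: scalar[symmetric])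
qed

end

definition mult_coords ::
  "nat \<Rightarrow> (nat \<Rightarrow> nat \<Rightarrow> nat \<Rightarrow> int) \<Rightarrow> (nat \<Rightarrow> int) \<Rightarrow> (nat \<Rightarrow> int) \<Rightarrow> nat \<Rightarrow> int"
  where "mult_coords n c x y l = (\<Sum>i\<le>n. \<Sum>j\<le>n. x i * y j * c i j l)"

context explicitly_given_finite_Z_algebra
begin

text \<open>Both sides are biadditive in the coordinates, and for two generators the claim is the
  defining property of the structure constants.\<close>

lemma zlincomb_mult:
  "zlincomb R n g x \<otimes> zlincomb R n g y = zlincomb R n g (mult_coords n c x y)"
proof -
  note closed = generators_closed
  have g: "g i \<in> carrier R" if "i \<le> n" for i
    using that closed by auto
  have inner: "([x i] \<cdot> g i) \<otimes> zlincomb R n g y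
      = zlincomb R n g (\<lambda>l. \<Sum>j\<le>n. x i * y j * c i j l)" if i: "i \<le> n" for i
  proof -
    have "([x i] \<cdot> g i) \<otimes> zlincomb R n g y
        = (\<Oplus>j\<in>{..n}. ([x i] \<cdot> g i) \<otimes> ([y j] \<cdot> g j))"
      unfolding zlincomb_def using g i by (intro finsum_rdistr) auto
    also have "\<dots> = (\<Oplus>j\<in>{..n}. zlincomb R n g (\<lambda>l. x i * y j * c i j l))"
    proof (intro finsum_cong')
      fix j assume "j \<in> {..n}"
      then have j: "j \<le> n" by simp
      have "([x i] \<cdot> g i) \<otimes> ([y j] \<cdot> g j) = [(x i * y j)] \<cdot> (g i \<otimes> g j)"
        using g i j
        by (simp add: add_pow_ldistr_int add_pow_rdistr_int add.int_pow_pow mult.commute)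
      then show "([x i] \<cdot> g i) \<otimes> ([y j] \<cdot> g j) = zlincomb R n g (\<lambda>l. x i * y j * c i j l)"
        using structure_constants[OF i j] zlincomb_smult[OF closed, of "x i * y j"] by simp
    qed (use closed in auto)
    also have "\<dots> = zlincomb R n g (\<lambda>l. \<Sum>j\<le>n. x i * y j * c i j l)"
      by (rule zlincomb_sum[OF closed, symmetric]) simp
    finally show ?thesis .
  qed
  have "zlincomb R n g x \<otimes> zlincomb R n g y
      = (\<Oplus>i\<in>{..n}. ([x i] \<cdot> g i) \<otimes> zlincomb R n g y)"
    unfolding zlincomb_def[of R n g x] using g closed by (intro finsum_ldistr) auto
  also have "\<dots> = (\<Oplus>i\<in>{..n}. zlincomb R n g (\<lambda>l. \<Sum>j\<le>n. x i * y j * c i j l))"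
    using closed inner by (intro finsum_cong') auto
  also have "\<dots> = zlincomb R n g (\<lambda>l. \<Sum>i\<le>n. \<Sum>j\<le>n. x i * y j * c i j l)"
    by (rule zlincomb_sum[OF closed, symmetric]) simp
  finally show ?thesis
    unfolding mult_coords_def .
qed

lemma zlincomb_eq_zero_iff_in_range_transpose:
  "zlincomb R n g a = \<zero> \<longleftrightarrow> (\<exists>w \<in> carrier_vec m. vec (Suc n) a = transpose_mat A *\<^sub>v w)"
proof -
  interpret Z: idom_vec "Suc n" "TYPE(int)" .
  have "zlincomb R n g (($) (vec (Suc n) a)) = zlincomb R n g a"
    unfolding zlincomb_def using generators_closed by (intro finsum_cong') auto
  then have "zlincomb R n g a = \<zero> \<longleftrightarrow> vec (Suc n) a \<in> syzygies R n g"
    unfolding syzygies_def by simp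
  also have "\<dots> \<longleftrightarrow> vec (Suc n) a \<in> (\<lambda>w. transpose_mat A *\<^sub>v w) ` carrier_vec m"
    using rows_generate_syzygies Z.span_rows_eq_range_transpose[OF relation_matrix] by simp
  finally show ?thesis by auto
qed

end

text \<open>Reading the integer system off coordinate by coordinate: the sums of multiples of
  standard basis vectors are written as the vectors of their coefficients.\<close>

lemma is_int_solution_iff:
  assumes A: "A \<in> carrier_mat m (Suc n)"
  shows "is_int_solution n m p A B c Z w \<longleftrightarrow>
    Z \<in> carrier_mat p (Suc n) \<and> w \<in> carrier_vec m \<and>
    vec (Suc n) (\<lambda>l. \<Sum>k<p. mult_coords n c (\<lambda>i. Z $$ (k, i)) (\<lambda>j. B $$ (k, j)) l)
      = transpose_mat A *\<^sub>v w"
proof -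
  define u where "u = finsum_vec TYPE(int) (Suc n)
      (\<lambda>(k, i, j, l). (Z $$ (k, i) * B $$ (k, j) * c i j l) \<cdot>\<^sub>v unit_vec (Suc n) l)
      ({..<p} \<times> {..n} \<times> {..n} \<times> {..n})"
  define v where "v = finsum_vec TYPE(int) (Suc n)
      (\<lambda>(j, i). (w $ j * A $$ (j, i)) \<cdot>\<^sub>v unit_vec (Suc n) i) ({..<m} \<times> {..n})"
  have u_carrier: "u \<in> carrier_vec (Suc n)" and v_carrier: "v \<in> carrier_vec (Suc n)"
    unfolding u_def v_def by (auto intro!: finsum_vec_closed)
  have u_eq: "u = vec (Suc n)
      (\<lambda>l. \<Sum>k<p. mult_coords n c (\<lambda>i. Z $$ (k, i)) (\<lambda>j. B $$ (k, j)) l)" (is "u = ?F")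
  proof (rule eq_vecI)
    fix t assume "t < dim_vec ?F"
    then have t: "t < Suc n" by simp
    have "u $ t = (\<Sum>(k, i, j, l)\<in>{..<p} \<times> {..n} \<times> {..n} \<times> {..n}.
        if t = l then Z $$ (k, i) * B $$ (k, j) * c i j l else 0)"
      unfolding u_def using t
      by (subst index_finsum_vec) (auto intro!: sum.cong)
    then show "u $ t = ?F $ t"
      using t by (simp add: mult_coords_def sum.delta flip: sum.cartesian_product)
  qed (use u_carrier in simp)
  have v_eq: "v = transpose_mat A *\<^sub>v w" if w: "w \<in> carrier_vec m"
  proof (rule eq_vecI)
    fix t assume "t < dim_vec (transpose_mat A *\<^sub>v w)"
    then have t: "t < Suc n" using A by simp
    have "v $ t = (\<Sum>(j, i)\<in>{..<m} \<times> {..n}. if t = i then w $ j * A $$ (j, i) else 0)"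
      unfolding v_def using t
      by (subst index_finsum_vec) (auto intro!: sum.cong)
    also have "\<dots> = (\<Sum>j<m. w $ j * A $$ (j, t))"
      using t by (simp add: sum.delta flip: sum.cartesian_product)
    also have "\<dots> = (transpose_mat A *\<^sub>v w) $ t"
      using A w t by (auto simp: scalar_prod_def atLeast0LessThan mult.commute intro!: sum.cong)
    finally show "v $ t = (transpose_mat A *\<^sub>v w) $ t" .
  qed (use v_carrier A in simp)
  have "u - v = 0\<^sub>v (Suc n) \<longleftrightarrow> u = v"
  proof
    assume diff: "u - v = 0\<^sub>v (Suc n)"
    show "u = v"
    proof (rule eq_vecI)
      fix t assume "t < dim_vec v"
      then show "u $ t = v $ t"
        using arg_cong[OF diff, of "\<lambda>x. x $ t"] u_carrier v_carrier by simp
    qed (use u_carrier v_carrier in simp)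
  qed (use v_carrier in auto)
  then show ?thesis
    unfolding is_int_solution_def u_def[symmetric] v_def[symmetric] u_eq[symmetric]
    using v_eq by auto
qed

theorem proposition2p6:
  fixes R :: "('a, 'b) ring_scheme"
    and n m p :: nat
    and g :: "nat \<Rightarrow> 'a"
    and A B D :: "int mat"
    and c :: "nat \<Rightarrow> nat \<Rightarrow> nat \<Rightarrow> int"
    and f h :: "nat \<Rightarrow> 'a"
  assumes "explicitly_given_finite_Z_algebra R n m g A c"
    and "f \<in> {..<p} \<rightarrow> carrier R"
    and "B \<in> carrier_mat p (Suc n)"
    and "\<And>k. k < p \<Longrightarrow> f k = zlincomb R n g (\<lambda>j. B $$ (k, j))"
    and "h \<in> {..<p} \<rightarrow> carrier R"
    and "D \<in> carrier_mat p (Suc n)"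
    and "\<And>k. k < p \<Longrightarrow> h k = zlincomb R n g (\<lambda>i. D $$ (k, i))"
  shows "is_ring_solution R p f h \<longleftrightarrow> D \<in> z_projection n m p A B c"
proof -
  interpret explicitly_given_finite_Z_algebra R n m g A c
    by (rule assms(1))
  let ?F = "\<lambda>l. \<Sum>k<p. mult_coords n c (\<lambda>i. D $$ (k, i)) (\<lambda>j. B $$ (k, j)) l"
  have "(\<Oplus>\<^bsub>R\<^esub>k\<in>{..<p}. f k \<otimes>\<^bsub>R\<^esub> h k)
      = (\<Oplus>\<^bsub>R\<^esub>k\<in>{..<p}.
          zlincomb R n g (mult_coords n c (\<lambda>i. D $$ (k, i)) (\<lambda>j. B $$ (k, j))))"
  proof (intro finsum_cong')
    fix k assume "k \<in> {..<p}"
    then have k: "k < p" by simp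
    \<comment> \<open>The integer system pairs the first index of the structure constants with \<open>h\<close>, so the
      factors are swapped before taking coordinates.\<close>
    have "f k \<otimes>\<^bsub>R\<^esub> h k = h k \<otimes>\<^bsub>R\<^esub> f k"
      using assms(2,5) k by (intro m_comm) auto
    then show "f k \<otimes>\<^bsub>R\<^esub> h k
        = zlincomb R n g (mult_coords n c (\<lambda>i. D $$ (k, i)) (\<lambda>j. B $$ (k, j)))"
      using assms(4,7) k by (simp add: zlincomb_mult)
  qed (use generators_closed in auto)
  also have "\<dots> = zlincomb R n g ?F"
    by (rule zlincomb_sum[OF generators_closed, symmetric]) simp
  finally have "is_ring_solution R p f h \<longleftrightarrow> zlincomb R n g ?F = \<zero>\<^bsub>R\<^esub>"
    unfolding is_ring_solution_def using assms(5) by simp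
  also have "\<dots> \<longleftrightarrow> (\<exists>w \<in> carrier_vec m. vec (Suc n) ?F = transpose_mat A *\<^sub>v w)"
    by (rule zlincomb_eq_zero_iff_in_range_transpose)
  also have "\<dots> \<longleftrightarrow> D \<in> z_projection n m p A B c"
    unfolding z_projection_def using assms(6) is_int_solution_iff[OF relation_matrix] by auto
  finally show ?thesis .
qed

end
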